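(* Let $g\in H(\mathbb{D})$ be such that $\log(g')\in\mathcal{B}$, let $\nu$ be an analytic weight and let $\mu$ be an arbitrary weight. Then $T_g: H^{\infty}_\nu\rightarrow H^{\infty}_\mu$ is bounded if and only if $$\sup_{0\leq t<1}\ \sup_{0\leq\theta<2\pi}\mu(t)\int_0^t\frac{|g'(re^{i\theta})|}{\nu(r)}\,dr<+\infty\,.$$
   Context: $\mathbb{D}$ is the open unit disk and $H(\mathbb{D})$ the space of analytic functions on $\mathbb{D}$. A weight is a non-negative continuous function $\nu$ on $\mathbb{D}$ with $\nu(z)=\nu(|z|)$ for all $z$, which is decreasing in $|z|$; we write $\nu(r)$ for its value at $|z|=r$. For a weight $\nu$, $H^{\infty}_\nu=\{f\in H(\mathbb{D}): \|f\|_{H^\infty_\nu}:=\sup_{z\in\mathbb{D}}\nu(z)|f(z)|<\infty\}$. The Bloch space is $\mathcal{B}=\{f\in H(\mathbb{D}): |f(0)|+\sup_{z\in\mathbb{D}}(1-|z|^2)|f'(z)|<\infty\}$; "$\log(g')\in\mathcal{B}$" means $g'$ has no zeros in $\mathbb{D}$ and an analytic branch of $\log g'$ belongs to $\mathcal{B}$. A weight $\nu$ is analytic if $\nu(z)=1/F(|z|)$ for some $F\in H(\mathbb{D})$ with $|F(z)|\leq F(|z|)$ for all $z\in\mathbb{D}$. For $g\in H(\mathbb{D})$, the Volterra type operator is $(T_gf)(z)=\int_0^z f(\omega)g'(\omega)\,d\omega$. *)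

theory Defs
  imports "HOL-Complex_Analysis.Complex_Analysis"
begin

abbreviation unit_disc :: "complex set" where
  "unit_disc \<equiv> ball 0 1"

text \<open>A weight: non-negative, continuous, radial, and (non-strictly) decreasing in the modulus.
  For a weight nu we write nu(r) as nu (of_real r).\<close>
definition is_weight :: "(complex \<Rightarrow> real) \<Rightarrow> bool" where
  "is_weight \<nu> \<longleftrightarrow>
     continuous_on unit_disc \<nu> \<and>
     (\<forall>z\<in>unit_disc. 0 \<le> \<nu> z) \<and>
     (\<forall>z\<in>unit_disc. \<nu> z = \<nu> (complex_of_real (norm z))) \<and>
     (\<forall>z\<in>unit_disc. \<forall>w\<in>unit_disc. norm z \<le> norm w \<longrightarrow> \<nu> w \<le> \<nu> z)"

definition is_analytic_weight :: "(complex \<Rightarrow> real) \<Rightarrow> bool" where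
  "is_analytic_weight \<nu> \<longleftrightarrow> is_weight \<nu> \<and>
     (\<exists>F. F holomorphic_on unit_disc \<and>
        (\<forall>z\<in>unit_disc. complex_of_real (\<nu> z) * F (complex_of_real (norm z)) = 1) \<and>
        (\<forall>z\<in>unit_disc. F (complex_of_real (norm z)) \<in> \<real> \<and>
                         norm (F z) \<le> Re (F (complex_of_real (norm z)))))"

definition Hinf_w :: "(complex \<Rightarrow> real) \<Rightarrow> (complex \<Rightarrow> complex) set" where
  "Hinf_w \<nu> = {f. f holomorphic_on unit_disc \<and> bdd_above ((\<lambda>z. \<nu> z * norm (f z)) ` unit_disc)}"

definition Hinf_norm :: "(complex \<Rightarrow> real) \<Rightarrow> (complex \<Rightarrow> complex) \<Rightarrow> real" where
  "Hinf_norm \<nu> f = (SUP z\<in>unit_disc. \<nu> z * norm (f z))"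

definition bloch :: "(complex \<Rightarrow> complex) set" where
  "bloch = {h. h holomorphic_on unit_disc \<and>
               bdd_above ((\<lambda>z. (1 - (norm z)\<^sup>2) * norm (deriv h z)) ` unit_disc)}"

text \<open>log g' in the Bloch space: g' has an analytic logarithm on the disc lying in the Bloch space
  (this forces g' to be zero-free).\<close>
definition log_deriv_in_bloch :: "(complex \<Rightarrow> complex) \<Rightarrow> bool" where
  "log_deriv_in_bloch g \<longleftrightarrow>
     (\<exists>h\<in>bloch. \<forall>z\<in>unit_disc. exp (h z) = deriv g z)"

definition volterra :: "(complex \<Rightarrow> complex) \<Rightarrow> (complex \<Rightarrow> complex) \<Rightarrow> complex \<Rightarrow> complex" where
  "volterra g f z = contour_integral (linepath 0 z) (\<lambda>w. f w * deriv g w)"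

definition volterra_bounded ::
  "(complex \<Rightarrow> complex) \<Rightarrow> (complex \<Rightarrow> real) \<Rightarrow> (complex \<Rightarrow> real) \<Rightarrow> bool" where
  "volterra_bounded g \<nu> \<mu> \<longleftrightarrow>
     (\<forall>f\<in>Hinf_w \<nu>. volterra g f \<in> Hinf_w \<mu>) \<and>
     (\<exists>C. \<forall>f\<in>Hinf_w \<nu>. Hinf_norm \<mu> (volterra g f) \<le> C * Hinf_norm \<nu> f)"

end

theory Submission
  imports Defs "HOL-Probability.Probability"
begin

text \<open>
  Sufficiency is the radial estimate of the integral. For necessity one needs, for each ray, a test
  function on which the integrand of \<open>T\<^sub>g f\<close> has essentially no oscillation, that is, one has to cancel
  the argument \<open>Im h\<close> of \<open>g' = exp h\<close> along the ray at bounded cost on the whole disc.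

  The map \<open>z \<mapsto> - B Ln (1 - z)\<close> sends the disc into the strip \<open>\<bar>Im w\<bar> < B \<pi> / 2\<close> and the
  radius \<open>[0,1)\<close> onto \<open>[0,\<infinity>)\<close>; if \<open>B\<close> bounds the Bloch seminorm of \<open>h\<close>, then \<open>Im h\<close> is
  1-Lipschitz in \<open>w\<close> on that radius. Convolving a 1-Lipschitz function with the standard Gaussian gives an
  entire function which differs from it by at most \<open>sqrt (2 / \<pi>)\<close> on the real line, and whose imaginary
  part is at most \<open>exp (y\<^sup>2 / 2)\<close> at height \<open>y\<close>, hence bounded in the strip. Pulling back gives
  \<open>\<phi>\<close> on the disc with bounded imaginary part and \<open>\<bar>Re \<phi> - Im h\<bar> \<le> 1 < \<pi> / 2\<close> on the
  ray, and \<open>f = F exp (-i \<phi>)\<close>, rotated to the ray, is the test function when \<open>\<nu> = 1 / F\<close>.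
\<close>

section \<open>Gaussian smoothing of Lipschitz functions\<close>

lemma std_normal_fourier:
  fixes y :: real
  shows "(\<integral>s. of_real (std_normal_density s) * exp (\<i> * of_real (y * s)) \<partial>lborel)
    = complex_of_real (exp (- y\<^sup>2 / 2))"
proof -
  have "char std_normal_distribution y = complex_of_real (exp (- (y\<^sup>2) / 2))"
    by (simp add: char_std_normal_distribution)
  moreover have "char std_normal_distribution y
      = (\<integral>s. std_normal_density s *\<^sub>R exp (\<i> * of_real (y * s)) \<partial>lborel)"
    unfolding char_def by (subst integral_density) (auto simp: normal_density_nonneg)
  ultimately show ?thesis
    by (simp add: scaleR_conv_of_real)
qed

text \<open>The error at \<open>w = x + i y\<close> is \<open>exp (y\<^sup>2 / 2)\<close> times the
  integral of \<open>v (x + s) - v x\<close> against the normal density and a unimodular factor; the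
  Lipschitz bound reduces it to the first absolute moment. Compact support turns the convolution
  into an integral over a fixed interval, where differentiation under the integral sign gives an
  entire function.\<close>

lemma gaussian_smoothing:
  fixes v :: "real \<Rightarrow> real"
  assumes lip: "\<And>s t. \<bar>v s - v t\<bar> \<le> \<bar>s - t\<bar>"
    and supp: "\<And>t. t \<notin> {a..b} \<Longrightarrow> v t = 0"
  obtains \<psi> where "\<psi> holomorphic_on UNIV"
    "\<And>w. norm (\<psi> w - of_real (v (Re w))) \<le> exp ((Im w)\<^sup>2 / 2)"
proof
  \<comment> \<open>\<open>K w t\<close> is \<open>v t\<close> times the standard normal density,
    continued analytically and evaluated at \<open>w - t\<close>.\<close>
  define K :: "complex \<Rightarrow> real \<Rightarrow> complex"
    where "K w t = of_real (v t) * (exp (- (w - of_real t)\<^sup>2 / 2) / of_real (sqrt (2 * pi)))" for w t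
  define \<psi> where "\<psi> w = integral (cbox a b) (K w)" for w
  have contv: "continuous_on UNIV v"
    unfolding continuous_on_iff dist_real_def by (meson lip le_less_trans)
  have cv: "continuous_on A (\<lambda>t. v (f t))" if "continuous_on A f" for A :: "'z::topological_space set" and f
    using continuous_on_compose2[OF contv that] by simp
  have [measurable]: "v \<in> borel_measurable borel"
    using contv by (rule borel_measurable_continuous_onI)
  show "\<psi> holomorphic_on UNIV"
    unfolding \<psi>_def
  proof (rule leibniz_rule_holomorphic)
    show "((\<lambda>w. K w t) has_field_derivative - (x - of_real t) * K x t) (at x within UNIV)" for x t
      unfolding K_def by (auto intro!: derivative_eq_intros simp: field_simps)
    show "K x integrable_on cbox a b" for x
      unfolding K_def by (intro integrable_continuous continuous_intros cv) auto
    show "continuous_on (UNIV \<times> cbox a b) (\<lambda>(x, t). - (x - of_real t) * K x t)"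
      unfolding K_def split_beta by (intro continuous_intros cv) auto
  qed auto
  fix w :: complex
  define x y where "x = Re w" and "y = Im w"
  have w: "w = of_real x + \<i> * of_real y"
    by (simp add: x_def y_def complex_eq)
  \<comment> \<open>With \<open>t = x + s\<close>, \<open>N s\<close> is what remains of the
    Gaussian factor once \<open>exp (y\<^sup>2 / 2)\<close> is pulled out.\<close>
  define N where "N s = of_real (std_normal_density s) * exp (\<i> * of_real (y * s))" for s
  have normN: "norm (N s) = std_normal_density s" for s
    by (simp add: N_def norm_mult)
  have [measurable]: "N \<in> borel_measurable borel"
    unfolding N_def by measurable
  have N_int: "integrable lborel N"
    by (rule Bochner_Integration.integrable_bound[OF integrable_std_normal_moment[of 0]])
       (auto simp: normN)
  have dom: "integrable lborel (\<lambda>s. std_normal_density s * \<bar>s\<bar>)"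
    using integrable_std_normal_moment_abs[of 1] by simp
  have bnd: "norm (of_real (v (x + s) - v x) * N s) \<le> std_normal_density s * \<bar>s\<bar>" for s
    using lip[of "x + s" x]
    by (simp add: norm_mult normN mult.commute[of _ "std_normal_density s"] mult_left_mono
        flip: of_real_diff)
  have D_int: "integrable lborel (\<lambda>s. of_real (v (x + s) - v x) * N s)"
    by (rule Bochner_Integration.integrable_bound[OF dom])
       (use bnd in \<open>auto simp: normal_density_nonneg abs_mult\<close>)
  have "norm (\<integral>s. of_real (v (x + s) - v x) * N s \<partial>lborel)
      \<le> (\<integral>s. std_normal_density s * \<bar>s\<bar> \<partial>lborel)"
    by (rule Bochner_Integration.integral_norm_bound_integral[OF D_int dom]) (rule bnd)
  also have "\<dots> = sqrt (2 / pi)"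
    using integral_std_normal_moment_abs_odd[of 0] by simp
  also have "\<dots> \<le> 1"
    using pi_ge_two by (simp add: field_simps)
  finally have le1: "norm (\<integral>s. of_real (v (x + s) - v x) * N s \<partial>lborel) \<le> 1" .
  have K_eq: "K w (x + s) = of_real (exp (y\<^sup>2 / 2)) * (of_real (v (x + s)) * N s)" for s
  proof -
    have "- (w - of_real (x + s))\<^sup>2 / 2
        = of_real (y\<^sup>2 / 2) + of_real (- s\<^sup>2 / 2) + \<i> * of_real (y * s)"
      by (simp add: w power2_eq_square field_simps)
    then have "exp (- (w - of_real (x + s))\<^sup>2 / 2)
        = of_real (exp (y\<^sup>2 / 2)) * of_real (exp (- s\<^sup>2 / 2)) * exp (\<i> * of_real (y * s))"
      by (simp only: exp_add exp_of_real)
    then show ?thesis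
      by (simp add: K_def N_def std_normal_density_def)
  qed
  \<comment> \<open>The constant \<open>v x\<close> integrates to
    \<open>v x * exp (- y\<^sup>2 / 2)\<close>, which the prefactor restores to \<open>v x\<close>;
    only the increment contributes to the error.\<close>
  have vN: "of_real (v (x + s)) * N s
      = of_real (v (x + s) - v x) * N s + of_real (v x) * N s" for s
    by (simp add: algebra_simps)
  have vN_int: "integrable lborel (\<lambda>s. of_real (v (x + s)) * N s)"
    unfolding vN using D_int N_int by auto
  have "integrable lborel (\<lambda>s. K w (x + 1 * s))"
    using vN_int by (simp add: K_eq)
  then have K_int: "integrable lborel (K w)"
    by (subst (asm) lborel_integrable_real_affine_iff) auto
  have "\<psi> w = integral UNIV (\<lambda>t. if t \<in> cbox a b then K w t else 0)"
    unfolding \<psi>_def integral_restrict_UNIV ..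
  also have "(\<lambda>t. if t \<in> cbox a b then K w t else 0) = K w"
    using supp by (auto simp: K_def)
  also have "integral UNIV (K w) = (\<integral>t. K w t \<partial>lborel)"
    by (rule integral_unique[OF has_integral_integral_lborel[OF K_int]])
  also have "\<dots> = (\<integral>s. K w (x + s) \<partial>lborel)"
    by (subst lborel_integral_real_affine[where c = 1 and t = x]) auto
  also have "\<dots> = of_real (exp (y\<^sup>2 / 2)) * (\<integral>s. of_real (v (x + s)) * N s \<partial>lborel)"
    by (simp add: K_eq)
  also have "(\<integral>s. of_real (v (x + s)) * N s \<partial>lborel)
      = (\<integral>s. of_real (v (x + s) - v x) * N s \<partial>lborel) + (\<integral>s. of_real (v x) * N s \<partial>lborel)"
    unfolding vN using D_int N_int by (intro Bochner_Integration.integral_add) auto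
  also have "(\<integral>s. of_real (v x) * N s \<partial>lborel) = of_real (v x) * of_real (exp (- y\<^sup>2 / 2))"
    using std_normal_fourier[of y] by (simp add: N_def)
  finally have "\<psi> w - of_real (v x)
      = of_real (exp (y\<^sup>2 / 2)) * (\<integral>s. of_real (v (x + s) - v x) * N s \<partial>lborel)"
    by (simp add: algebra_simps flip: exp_add of_real_mult)
  then show "norm (\<psi> w - of_real (v (Re w))) \<le> exp ((Im w)\<^sup>2 / 2)"
    using le1 unfolding x_def y_def by (simp add: norm_mult del: of_real_diff)
qed

section \<open>Analytic approximation of the phase on a radius\<close>

text \<open>The substitution \<open>s = - B * ln (1 - r)\<close> makes the phase 1-Lipschitz in
  \<open>s\<close>. The bound on \<open>Im \<phi>\<close> depends on \<open>B\<close> but not on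
  \<open>t\<close>, which later gives a constant uniform in \<open>t\<close>.\<close>

lemma bloch_radial_approximation:
  fixes h :: "complex \<Rightarrow> complex"
  assumes holo: "h holomorphic_on unit_disc" and "1 \<le> B" "0 \<le> t" "t < 1"
    and B: "\<And>z. z \<in> unit_disc \<Longrightarrow> (1 - (norm z)\<^sup>2) * norm (deriv h z) \<le> B"
  obtains \<phi> where "\<phi> holomorphic_on unit_disc"
    "\<And>z. z \<in> unit_disc \<Longrightarrow> \<bar>Im (\<phi> z)\<bar> \<le> exp ((B * pi / 2)\<^sup>2 / 2)"
    "\<And>r. r \<in> {0..t} \<Longrightarrow> \<bar>Re (\<phi> (of_real r)) - Im (h (of_real r))\<bar> \<le> 1"
proof -
  \<comment> \<open>Subtracting the value at 0 makes \<open>p (q s)\<close> vanish wherever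
    \<open>q s = 0\<close>; the real constant is put back in \<open>\<phi>\<close>.\<close>
  define U where "U r = Im (h (of_real r)) - Im (h 0)" for r
  define p where "p s = U (1 - exp (- s / B))" for s
  define T where "T = - B * ln (1 - t)"
  \<comment> \<open>Only the segment \<open>[0,t]\<close> matters; reflecting at its endpoint \<open>T\<close> makes the Lipschitz
    function compactly supported.\<close>
  define q where "q s = max 0 (T - \<bar>s - T\<bar>)" for s
  have "0 < B" using \<open>1 \<le> B\<close> by simp
  have U_deriv: "(U has_real_derivative Im (deriv h (of_real r))) (at r)" if "0 \<le> r" "r < 1" for r
  proof -
    have "(h has_field_derivative deriv h (of_real r)) (at (of_real r))"
      by (rule holomorphic_derivI[OF holo]) (use that in auto)
    then have "((\<lambda>r. h (of_real r)) has_vector_derivative deriv h (of_real r)) (at r)"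
      by (rule has_vector_derivative_real_field)
    then have "((\<lambda>r. Im (h (of_real r))) has_real_derivative Im (deriv h (of_real r))) (at r)"
      unfolding has_real_derivative_iff_has_vector_derivative
      by (rule bounded_linear.has_vector_derivative[OF bounded_linear_Im])
    from DERIV_diff[OF this DERIV_const[of "Im (h 0)"]] show ?thesis
      by (simp add: U_def[abs_def])
  qed
  have p_lip: "\<bar>p r - p s\<bar> \<le> \<bar>r - s\<bar>" if "0 \<le> r" "0 \<le> s" for r s
  proof -
    \<comment> \<open>Mean value inequality: the chain rule factor is \<open>(1 - x) / B\<close> at
      \<open>x = 1 - exp (- s / B)\<close>, and \<open>1 - x \<le> 1 - x\<^sup>2\<close> brings in
      the Bloch bound.\<close>
    have "norm (p r - p s) \<le> 1 * norm (r - s)"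
    proof (rule field_differentiable_bound[where S = "{0..}" and
          f' = "\<lambda>s. Im (deriv h (of_real (1 - exp (- s / B)))) * (exp (- s / B) / B)"])
      fix s :: real assume s: "s \<in> {0..}"
      define x where "x = 1 - exp (- s / B)"
      have x: "0 \<le> x" "x < 1" using s \<open>0 < B\<close> by (auto simp: x_def)
      have "((\<lambda>s. 1 - exp (- s / B)) has_real_derivative exp (- s / B) / B) (at s within {0..})"
        using \<open>0 < B\<close> by (auto intro!: derivative_eq_intros)
      from DERIV_chain2[OF U_deriv[OF x, unfolded x_def] this]
      show "(p has_real_derivative Im (deriv h (of_real (1 - exp (- s / B)))) * (exp (- s / B) / B))
          (at s within {0..})"
        unfolding p_def .
      have "(1 - x) * norm (deriv h (of_real x)) \<le> (1 - x\<^sup>2) * norm (deriv h (of_real x))"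
        using x by (intro mult_right_mono) (auto simp: power2_eq_square mult_left_le_one_le)
      also have "\<dots> \<le> B"
        using B[of "of_real x"] x by simp
      finally have le: "(1 - x) * norm (deriv h (of_real x)) \<le> B" .
      have "(1 - x) * \<bar>Im (deriv h (of_real x))\<bar> \<le> (1 - x) * norm (deriv h (of_real x))"
        using x by (intro mult_left_mono abs_Im_le_cmod) auto
      with le have "(1 - x) * \<bar>Im (deriv h (of_real x))\<bar> \<le> B" by linarith
      then have "\<bar>Im (deriv h (of_real x))\<bar> * ((1 - x) / B) \<le> 1"
        using \<open>0 < B\<close> by (simp add: field_simps)
      then show "norm (Im (deriv h (of_real (1 - exp (- s / B)))) * (exp (- s / B) / B)) \<le> 1"
        using \<open>0 < B\<close> by (simp add: x_def abs_mult)
    qed (use that in auto)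
    then show ?thesis by simp
  qed
  have q_lip: "\<bar>q r - q s\<bar> \<le> \<bar>r - s\<bar>" and q_nonneg: "0 \<le> q s" for r s
    unfolding q_def by linarith+
  \<comment> \<open>\<open>q\<close> folds the line into the half-line on which \<open>p\<close> is
    1-Lipschitz.\<close>
  have "\<bar>p (q r) - p (q s)\<bar> \<le> \<bar>r - s\<bar>" for r s
    using p_lip[OF q_nonneg q_nonneg, of r s] q_lip[of r s] by linarith
  moreover have "p (q s) = 0" if "s \<notin> {0..2 * T}" for s
  proof -
    have "q s = 0" using that by (auto simp: q_def)
    then show ?thesis by (simp add: p_def U_def)
  qed
  ultimately obtain \<psi> where \<psi>: "\<psi> holomorphic_on UNIV"
    "\<And>w. norm (\<psi> w - of_real (p (q (Re w)))) \<le> exp ((Im w)\<^sup>2 / 2)"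
    using gaussian_smoothing[of "\<lambda>s. p (q s)"] by blast
  define \<omega> where "\<omega> z = - of_real B * Ln (1 - z)" for z
  define \<phi> where "\<phi> z = \<psi> (\<omega> z) + of_real (Im (h 0))" for z
  have pos: "0 < Re (1 - z)" if "z \<in> unit_disc" for z
    using that complex_Re_le_cmod[of z] by simp
  show ?thesis
  proof
    have "\<omega> holomorphic_on unit_disc"
      unfolding \<omega>_def using pos
      by (intro holomorphic_intros) (force simp: complex_nonpos_Reals_iff)+
    then have "(\<psi> \<circ> \<omega>) holomorphic_on unit_disc"
      using \<psi>(1) by (rule holomorphic_on_compose_gen) auto
    then show "\<phi> holomorphic_on unit_disc"
      unfolding \<phi>_def o_def by (intro holomorphic_intros)
    show "\<bar>Im (\<phi> z)\<bar> \<le> exp ((B * pi / 2)\<^sup>2 / 2)" if "z \<in> unit_disc" for z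
    proof -
      have "\<bar>Im (Ln (1 - z))\<bar> \<le> pi / 2"
        using Re_Ln_pos_lt_imp[OF pos[OF that]] by simp
      then have "\<bar>Im (\<omega> z)\<bar> \<le> B * (pi / 2)"
        using \<open>0 < B\<close> by (simp add: \<omega>_def abs_mult)
      then have le: "(Im (\<omega> z))\<^sup>2 \<le> (B * pi / 2)\<^sup>2"
        by (intro abs_le_square_iff[THEN iffD1]) simp
      \<comment> \<open>The subtracted value and the added constant are real, so the smoothing error
        alone bounds the imaginary part.\<close>
      have "\<bar>Im (\<phi> z)\<bar> = \<bar>Im (\<psi> (\<omega> z) - of_real (p (q (Re (\<omega> z)))))\<bar>"
        by (simp add: \<phi>_def)
      also have "\<dots> \<le> exp ((Im (\<omega> z))\<^sup>2 / 2)"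
        using abs_Im_le_cmod \<psi>(2) order_trans by blast
      also have "\<dots> \<le> exp ((B * pi / 2)\<^sup>2 / 2)"
        using le by simp
      finally show ?thesis .
    qed
    show "\<bar>Re (\<phi> (of_real r)) - Im (h (of_real r))\<bar> \<le> 1" if "r \<in> {0..t}" for r
    proof -
      define s where "s = - B * ln (1 - r)"
      have r: "0 \<le> r" "r \<le> t" "r < 1" using that \<open>t < 1\<close> by auto
      have "Ln (1 - of_real r) = of_real (ln (1 - r))"
        using r Ln_of_real[of "1 - r"] by simp
      then have \<omega>: "\<omega> (of_real r) = of_real s"
        by (simp add: \<omega>_def s_def)
      have "ln (1 - r) \<le> 0" "ln (1 - t) \<le> ln (1 - r)"
        using r \<open>t < 1\<close> by auto
      then have "0 \<le> s" "s \<le> T"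
        using \<open>0 < B\<close> by (auto simp: s_def T_def mult_le_0_iff)
      \<comment> \<open>Up to \<open>T\<close> the reflection has not set in; moreover
        \<open>\<omega>\<close> is real on the radius, so the smoothing error there is at most
        \<open>exp 0 = 1\<close>.\<close>
      then have "q s = s" by (simp add: q_def)
      moreover have "exp (- s / B) = 1 - r"
        using r \<open>0 < B\<close> by (simp add: s_def)
      ultimately have "p (q s) = U r" by (simp add: p_def)
      then have "norm (\<psi> (of_real s) - of_real (U r)) \<le> 1"
        using \<psi>(2)[of "of_real s"] by simp
      then have "\<bar>Re (\<psi> (of_real s) - of_real (U r))\<bar> \<le> 1"
        using abs_Re_le_cmod order_trans by blast
      then show ?thesis
        by (simp add: \<phi>_def \<omega> U_def algebra_simps)
    qed
  qed
qed

section \<open>Radial integrals, weights and weighted norms\<close>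

text \<open>The disc is convex, so the integrand has a primitive \<open>P\<close> and
  \<open>volterra g f\<close> is \<open>P - P 0\<close> there; the radial formula is the fundamental
  theorem of calculus for \<open>P\<close> along a ray.\<close>

lemma volterra_has_radial_integral:
  assumes "f holomorphic_on unit_disc" "g holomorphic_on unit_disc"
    and "norm c = 1" "0 \<le> t" "t < 1"
  shows "((\<lambda>r. f (of_real r * c) * deriv g (of_real r * c) * c)
      has_integral volterra g f (of_real t * c)) {0..t}"
    and "volterra g f holomorphic_on unit_disc"
proof -
  let ?k = "\<lambda>w. f w * deriv g w"
  have "?k holomorphic_on unit_disc"
    using assms by (intro holomorphic_intros holomorphic_deriv) auto
  then obtain P where P: "\<And>z. z \<in> unit_disc \<Longrightarrow> (P has_field_derivative ?k z) (at z within unit_disc)"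
    using holomorphic_convex_primitive'[of unit_disc ?k] by auto
  have vol: "volterra g f z = P z - P 0" if "z \<in> unit_disc" for z
  proof -
    have "closed_segment 0 z \<subseteq> unit_disc"
      using that by (intro closed_segment_subset) auto
    then have "(?k has_contour_integral P (pathfinish (linepath 0 z)) - P (pathstart (linepath 0 z)))
        (linepath 0 z)"
      by (intro contour_integral_primitive[OF P]) auto
    then show ?thesis
      unfolding volterra_def by (simp add: contour_integral_unique)
  qed
  have "(\<lambda>z. P z - P 0) holomorphic_on unit_disc"
    using P by (intro holomorphic_intros) (meson holomorphic_on_def field_differentiable_def)
  then show "volterra g f holomorphic_on unit_disc"
    by (rule holomorphic_transform) (simp add: vol)
  have "((\<lambda>r. ?k (of_real r * c) * c) has_integral P (of_real t * c) - P (of_real 0 * c)) {0..t}"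
  proof (rule fundamental_theorem_of_calculus[OF \<open>0 \<le> t\<close>])
    fix r assume "r \<in> {0..t}"
    then have "of_real r * c \<in> unit_disc"
      using assms by (simp add: norm_mult)
    then have "(P has_field_derivative ?k (of_real r * c)) (at (of_real r * c))"
      using P at_within_open[OF _ open_ball] by metis
    then have "((\<lambda>z. P (z * c)) has_field_derivative ?k (of_real r * c) * c) (at (of_real r))"
      by (rule DERIV_chain2) (auto intro!: derivative_eq_intros)
    then show "((\<lambda>r. P (of_real r * c)) has_vector_derivative ?k (of_real r * c) * c)
        (at r within {0..t})"
      by (rule has_vector_derivative_real_field)
  qed
  then show "((\<lambda>r. f (of_real r * c) * deriv g (of_real r * c) * c)
      has_integral volterra g f (of_real t * c)) {0..t}"
    using assms by (simp add: vol norm_mult)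
qed

lemma analytic_weight_pos:
  assumes "is_analytic_weight \<nu>" "z \<in> unit_disc"
  shows "0 < \<nu> z"
proof -
  have "0 \<le> \<nu> z" "\<nu> z \<noteq> 0"
    using assms unfolding is_analytic_weight_def is_weight_def
    by (blast, metis mult_zero_left of_real_0 zero_neq_one)
  then show ?thesis by simp
qed

lemma weight_nonneg:
  assumes "is_weight \<nu>" "z \<in> unit_disc"
  shows "0 \<le> \<nu> z"
  using assms unfolding is_weight_def by blast

lemma weight_rotate:
  assumes "is_weight \<nu>" "0 \<le> r" "r < 1"
  shows "\<nu> (of_real r * cis \<theta>) = \<nu> (of_real r)"
proof -
  have "of_real r * cis \<theta> \<in> unit_disc"
    using assms by (simp add: norm_mult)
  then have "\<nu> (of_real r * cis \<theta>) = \<nu> (of_real (norm (of_real r * cis \<theta>)))"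
    using assms(1) unfolding is_weight_def by blast
  then show ?thesis
    using assms by (simp add: norm_mult)
qed

text \<open>An analytic weight has no zeros, so the integrand is continuous. Integrability matters
  because \<open>integral\<close> would otherwise default to 0.\<close>

lemma weighted_deriv_integrable:
  assumes "g holomorphic_on unit_disc" "is_analytic_weight \<nu>" "norm c = 1" "t < 1"
  shows "(\<lambda>r. norm (deriv g (of_real r * c)) / \<nu> (of_real r)) integrable_on {0..t}"
proof (rule integrable_continuous_real)
  have "continuous_on unit_disc (deriv g)"
    using assms by (intro holomorphic_on_imp_continuous_on holomorphic_deriv) auto
  then have 1: "continuous_on {0..t} (\<lambda>r. deriv g (of_real r * c))"
    by (rule continuous_on_compose2) (use assms in \<open>auto intro!: continuous_intros simp: norm_mult\<close>)
  have "continuous_on unit_disc \<nu>"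
    using assms by (simp add: is_analytic_weight_def is_weight_def)
  then have 2: "continuous_on {0..t} (\<lambda>r. \<nu> (of_real r))"
    by (rule continuous_on_compose2) (use assms in \<open>auto intro!: continuous_intros\<close>)
  have "\<nu> (of_real r) \<noteq> 0" if "r \<in> {0..t}" for r
    using analytic_weight_pos[OF assms(2), of "of_real r"] that assms by auto
  then show "continuous_on {0..t} (\<lambda>r. norm (deriv g (of_real r * c)) / \<nu> (of_real r))"
    by (intro continuous_intros 1 2) auto
qed

lemma Hinf_norm_upper:
  assumes "f \<in> Hinf_w \<nu>" "z \<in> unit_disc"
  shows "\<nu> z * norm (f z) \<le> Hinf_norm \<nu> f"
  using assms unfolding Hinf_w_def Hinf_norm_def by (auto intro: cSUP_upper)

lemma Hinf_norm_least:
  assumes "\<And>z. z \<in> unit_disc \<Longrightarrow> \<nu> z * norm (f z) \<le> C"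
  shows "Hinf_norm \<nu> f \<le> C"
  unfolding Hinf_norm_def using assms by (intro cSUP_least) auto

lemma Hinf_wI:
  assumes "f holomorphic_on unit_disc" "\<And>z. z \<in> unit_disc \<Longrightarrow> \<nu> z * norm (f z) \<le> C"
  shows "f \<in> Hinf_w \<nu>"
  using assms unfolding Hinf_w_def by (auto intro!: bdd_aboveI2)

section \<open>Sufficiency of the integral condition\<close>

text \<open>On each ray \<open>norm f\<close> is at most \<open>Hinf_norm \<nu> f / \<nu>\<close>,
  and \<open>C\<close> itself serves as the operator bound.\<close>

lemma volterra_bounded_if:
  assumes g: "g holomorphic_on unit_disc"
    and \<nu>: "is_analytic_weight \<nu>" and \<mu>: "is_weight \<mu>"
    and C: "\<And>t \<theta>. t \<in> {0..<1} \<Longrightarrow> \<theta> \<in> {0..<2*pi} \<Longrightarrow>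
      \<mu> (of_real t) * integral {0..t} (\<lambda>r. norm (deriv g (of_real r * cis \<theta>)) / \<nu> (of_real r)) \<le> C"
  shows "volterra_bounded g \<nu> \<mu>"
proof -
  have bound: "\<mu> z * norm (volterra g f z) \<le> C * Hinf_norm \<nu> f"
    if f: "f \<in> Hinf_w \<nu>" and z: "z \<in> unit_disc" for f z
  proof -
    \<comment> \<open>\<open>Arg2pi\<close> takes its values in \<open>[0, 2 pi)\<close>, the range
      of angles in the hypothesis.\<close>
    define t \<theta> where "t = norm z" and "\<theta> = Arg2pi z"
    let ?I = "\<lambda>r. norm (deriv g (of_real r * cis \<theta>)) / \<nu> (of_real r)"
    have t: "t \<in> {0..<1}" and \<theta>: "\<theta> \<in> {0..<2*pi}"
      using z by (auto simp: t_def \<theta>_def Arg2pi_ge_0 Arg2pi_lt_2pi)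
    have z_eq: "z = of_real t * cis \<theta>"
      unfolding t_def \<theta>_def by (metis Arg2pi_eq cis_conv_exp)
    have norm0: "0 \<le> Hinf_norm \<nu> f"
      using Hinf_norm_upper[OF f, of 0] analytic_weight_pos[OF \<nu>, of 0]
      by (smt (verit) centre_in_ball mult_nonneg_nonneg norm_ge_zero)
    have "f holomorphic_on unit_disc"
      using f by (simp add: Hinf_w_def)
    note V = volterra_has_radial_integral(1)[OF this g, of "cis \<theta>" t]
    have "norm (volterra g f z) \<le> integral {0..t} (\<lambda>r. Hinf_norm \<nu> f * ?I r)"
      unfolding z_eq
    proof (subst integral_unique[OF V, symmetric]; (rule integral_norm_bound_integral)?)
      show "(\<lambda>r. f (of_real r * cis \<theta>) * deriv g (of_real r * cis \<theta>) * cis \<theta>) integrable_on {0..t}"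
        using V t by (auto simp: has_integral_integrable)
      show "(\<lambda>r. Hinf_norm \<nu> f * ?I r) integrable_on {0..t}"
        using weighted_deriv_integrable[OF g \<nu>, of "cis \<theta>" t] t by (intro integrable_on_mult_right) auto
      fix r assume r: "r \<in> {0..t}"
      let ?z = "of_real r * cis \<theta>"
      have in_disc: "?z \<in> unit_disc" using r t by (simp add: norm_mult)
      have "\<nu> ?z = \<nu> (of_real r)"
        using \<nu> r t by (intro weight_rotate) (auto simp: is_analytic_weight_def)
      then have "norm (f ?z) \<le> Hinf_norm \<nu> f / \<nu> (of_real r)"
        using Hinf_norm_upper[OF f in_disc] analytic_weight_pos[OF \<nu> in_disc]
        by (simp add: field_simps)
      then have "norm (f ?z) * norm (deriv g ?z) \<le> Hinf_norm \<nu> f / \<nu> (of_real r) * norm (deriv g ?z)"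
        by (rule mult_right_mono) simp
      then show "norm (f ?z * deriv g ?z * cis \<theta>) \<le> Hinf_norm \<nu> f * ?I r"
        by (simp add: norm_mult)
    qed (use t in auto)
    also have "\<dots> = Hinf_norm \<nu> f * integral {0..t} ?I"
      by (rule integral_mult_right)
    finally have "\<mu> z * norm (volterra g f z) \<le> \<mu> z * (Hinf_norm \<nu> f * integral {0..t} ?I)"
      using weight_nonneg[OF \<mu> z] by (intro mult_left_mono)
    also have "\<mu> z = \<mu> (of_real t)"
      using \<mu> z unfolding is_weight_def t_def by blast
    also have "\<mu> (of_real t) * (Hinf_norm \<nu> f * integral {0..t} ?I)
        = Hinf_norm \<nu> f * (\<mu> (of_real t) * integral {0..t} ?I)"
      by simp
    also have "\<dots> \<le> Hinf_norm \<nu> f * C"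
      using C[OF t \<theta>] norm0 by (rule mult_left_mono)
    finally show ?thesis by (simp add: \<open>\<mu> z = \<mu> (of_real t)\<close> mult.commute)
  qed
  have "volterra g f \<in> Hinf_w \<mu>" if f: "f \<in> Hinf_w \<nu>" for f
  proof (rule Hinf_wI)
    show "volterra g f holomorphic_on unit_disc"
      by (rule volterra_has_radial_integral(2)[of f g 1 0]) (use f g in \<open>auto simp: Hinf_w_def\<close>)
  qed (rule bound[OF f])
  then show ?thesis
    unfolding volterra_bounded_def using bound Hinf_norm_least by blast
qed

section \<open>Necessity of the integral condition\<close>

text \<open>Each ray and each \<open>t\<close> get their own test function, but its norm bound
  \<open>exp M\<close> and the loss factor \<open>\<kappa>\<close> depend only on the Bloch bound,
  so one constant serves all of them.\<close>

lemma volterra_bounded_only_if: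
  assumes g: "g holomorphic_on unit_disc" and "log_deriv_in_bloch g"
    and \<nu>: "is_analytic_weight \<nu>" and \<mu>: "is_weight \<mu>"
    and bdd: "volterra_bounded g \<nu> \<mu>"
  obtains C where "\<And>t \<theta>. t \<in> {0..<1} \<Longrightarrow>
      \<mu> (of_real t) * integral {0..t} (\<lambda>r. norm (deriv g (of_real r * cis \<theta>)) / \<nu> (of_real r)) \<le> C"
proof -
  obtain h where h: "h holomorphic_on unit_disc" and exp_h: "\<And>z. z \<in> unit_disc \<Longrightarrow> exp (h z) = deriv g z"
    and "bdd_above ((\<lambda>z. (1 - (norm z)\<^sup>2) * norm (deriv h z)) ` unit_disc)"
    using assms(2) unfolding log_deriv_in_bloch_def bloch_def by auto
  then obtain B0 where B0: "\<And>z. z \<in> unit_disc \<Longrightarrow> (1 - (norm z)\<^sup>2) * norm (deriv h z) \<le> B0"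
    unfolding bdd_above_def by blast
  \<comment> \<open>The maximum with 1 gives a scale that can be divided by even when
    \<open>h\<close> is constant.\<close>
  define B where "B = max 1 B0"
  define M where "M = exp ((B * pi / 2)\<^sup>2 / 2)"
  obtain F where F: "F holomorphic_on unit_disc"
    and F1: "\<And>z. z \<in> unit_disc \<Longrightarrow> complex_of_real (\<nu> z) * F (of_real (norm z)) = 1"
    and F2: "\<And>z. z \<in> unit_disc \<Longrightarrow> norm (F z) \<le> Re (F (of_real (norm z)))"
    using \<nu> unfolding is_analytic_weight_def by blast
  have F_eq: "F (of_real (norm z)) = of_real (1 / \<nu> z)" if "z \<in> unit_disc" for z
    using F1[OF that] analytic_weight_pos[OF \<nu> that] by (simp add: field_simps)
  obtain C where C: "\<And>f. f \<in> Hinf_w \<nu> \<Longrightarrow> Hinf_norm \<mu> (volterra g f) \<le> C * Hinf_norm \<nu> f"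
    and mem: "\<And>f. f \<in> Hinf_w \<nu> \<Longrightarrow> volterra g f \<in> Hinf_w \<mu>"
    using bdd unfolding volterra_bounded_def by auto
  \<comment> \<open>\<open>exp (- M)\<close> accounts for the modulus of the phase correction, and
    \<open>cos 1 > 0\<close> for the remaining phase error of at most 1.\<close>
  define \<kappa> where "\<kappa> = exp (- M) * cos 1"
  have "0 < cos (1::real)"
    using pi_gt3 by (intro cos_gt_zero) auto
  then have "0 < \<kappa>" by (simp add: \<kappa>_def)
  have "\<mu> (of_real t) * integral {0..t} (\<lambda>r. norm (deriv g (of_real r * cis \<theta>)) / \<nu> (of_real r))
      \<le> \<bar>C\<bar> * exp M / \<kappa>" if t: "t \<in> {0..<1}" for t \<theta>
  proof -
    let ?I = "\<lambda>r. norm (deriv g (of_real r * cis \<theta>)) / \<nu> (of_real r)"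
    let ?h = "\<lambda>z. h (z * cis \<theta>)"
    have rot: "z * cis \<alpha> \<in> unit_disc \<longleftrightarrow> z \<in> unit_disc" for z \<alpha>
      by (simp add: norm_mult)
    have rot_holo: "(\<lambda>z. k (z * cis \<alpha>)) holomorphic_on unit_disc" if "k holomorphic_on unit_disc" for k \<alpha>
    proof -
      have "(\<lambda>z. z * cis \<alpha>) ` unit_disc \<subseteq> unit_disc"
        using rot by blast
      moreover have "(\<lambda>z. z * cis \<alpha>) holomorphic_on unit_disc"
        by (intro holomorphic_intros)
      ultimately show ?thesis
        using holomorphic_on_compose_gen[OF _ that, of "\<lambda>z. z * cis \<alpha>" unit_disc] by (simp add: o_def)
    qed
    \<comment> \<open>Rotation preserves the Bloch bound, so the ray at angle
      \<open>\<theta>\<close> can be treated as the positive radius.\<close>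
    have "(1 - (norm z)\<^sup>2) * norm (deriv ?h z) \<le> B" if z: "z \<in> unit_disc" for z
    proof -
      have "(h has_field_derivative deriv h (z * cis \<theta>)) (at (z * cis \<theta>))"
        by (rule holomorphic_derivI[OF h]) (use z rot in auto)
      then have "(?h has_field_derivative deriv h (z * cis \<theta>) * cis \<theta>) (at z)"
        by (rule DERIV_chain2) (auto intro!: derivative_eq_intros)
      then have "norm (deriv ?h z) = norm (deriv h (z * cis \<theta>))"
        by (simp add: DERIV_imp_deriv norm_mult)
      then show ?thesis
        using B0[of "z * cis \<theta>"] rot z by (simp add: B_def norm_mult)
    qed
    then obtain \<phi> where \<phi>: "\<phi> holomorphic_on unit_disc"
      and Im_\<phi>: "\<And>z. z \<in> unit_disc \<Longrightarrow> \<bar>Im (\<phi> z)\<bar> \<le> M"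
      and Re_\<phi>: "\<And>r. r \<in> {0..t} \<Longrightarrow> \<bar>Re (\<phi> (of_real r)) - Im (?h (of_real r))\<bar> \<le> 1"
      using bloch_radial_approximation[of ?h B t] rot_holo[OF h] t unfolding M_def B_def by auto
    define f where "f z = F (z * cis (-\<theta>)) * exp (- \<i> * \<phi> (z * cis (-\<theta>)))" for z
    have f_holo: "f holomorphic_on unit_disc"
      unfolding f_def using rot_holo[OF F] rot_holo[OF \<phi>] by (intro holomorphic_intros)
    have f_le: "\<nu> z * norm (f z) \<le> exp M" if z: "z \<in> unit_disc" for z
    proof -
      have z': "z * cis (-\<theta>) \<in> unit_disc" using rot z by blast
      \<comment> \<open>Domination of \<open>F\<close> by its values on the positive radius keeps
        the rotated function within the weight.\<close>
      have "norm (F (z * cis (-\<theta>))) \<le> 1 / \<nu> z"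
        using F2[OF z'] F_eq[OF z] by (simp add: norm_mult)
      moreover have "norm (exp (- \<i> * \<phi> (z * cis (-\<theta>)))) \<le> exp M"
        using Im_\<phi>[OF z'] by simp
      ultimately have "norm (f z) \<le> 1 / \<nu> z * exp M"
        unfolding f_def norm_mult using analytic_weight_pos[OF \<nu> z] by (intro mult_mono) auto
      then show ?thesis
        using analytic_weight_pos[OF \<nu> z] by (simp add: field_simps)
    qed
    have f: "f \<in> Hinf_w \<nu>"
      using f_holo f_le by (rule Hinf_wI)
    let ?z = "of_real t * cis \<theta>"
    have z: "?z \<in> unit_disc" using t by (simp add: norm_mult)
    have "\<mu> ?z * norm (volterra g f ?z) \<le> C * Hinf_norm \<nu> f"
      using Hinf_norm_upper[OF mem[OF f] z] C[OF f] by simp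
    \<comment> \<open>The boundedness constant \<open>C\<close> comes without a sign, hence the
      absolute value.\<close>
    also have "\<dots> \<le> \<bar>C\<bar> * exp M"
    proof (rule mult_mono)
      show "Hinf_norm \<nu> f \<le> exp M" using f_le by (rule Hinf_norm_least)
      show "0 \<le> Hinf_norm \<nu> f"
        using Hinf_norm_upper[OF f, of 0] analytic_weight_pos[OF \<nu>, of 0]
        by (smt (verit) centre_in_ball mult_nonneg_nonneg norm_ge_zero)
    qed auto
    finally have upper: "\<mu> ?z * norm (volterra g f ?z) \<le> \<bar>C\<bar> * exp M" .
    have "((\<lambda>r. f (of_real r * cis \<theta>) * deriv g (of_real r * cis \<theta>) * cis \<theta>)
        has_integral volterra g f ?z) {0..t}"
      by (rule volterra_has_radial_integral[OF f_holo g]) (use t in auto)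
    \<comment> \<open>Multiplying by \<open>cis (-\<theta>)\<close> removes the tangent factor of
      the path, leaving only the phase of \<open>f * deriv g\<close>.\<close>
    from has_integral_mult_left[OF this, of "cis (-\<theta>)"]
    have V: "((\<lambda>r. f (of_real r * cis \<theta>) * deriv g (of_real r * cis \<theta>))
        has_integral volterra g f ?z * cis (-\<theta>)) {0..t}"
      by (simp add: mult.assoc cis_mult)
    have Re_V: "((\<lambda>r. Re (f (of_real r * cis \<theta>) * deriv g (of_real r * cis \<theta>)))
        has_integral Re (volterra g f ?z * cis (-\<theta>))) {0..t}"
      using has_integral_linear[OF V bounded_linear_Re] by (simp add: o_def)
    have "\<kappa> * integral {0..t} ?I = integral {0..t} (\<lambda>r. \<kappa> * ?I r)"
      by (rule integral_mult_right[symmetric])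
    also have "\<dots> \<le> Re (volterra g f ?z * cis (-\<theta>))"
    proof (rule has_integral_le[OF integrable_integral Re_V])
      show "(\<lambda>r. \<kappa> * ?I r) integrable_on {0..t}"
        using weighted_deriv_integrable[OF g \<nu>, of "cis \<theta>" t] t by (intro integrable_on_mult_right) auto
      fix r assume r: "r \<in> {0..t}"
      have r1: "of_real r \<in> unit_disc" and r2: "of_real r * cis \<theta> \<in> unit_disc"
        using r t by (auto simp: norm_mult)
      let ?a = "\<phi> (of_real r)" and ?b = "h (of_real r * cis \<theta>)"
      have Fr: "F (of_real r) = of_real (1 / \<nu> (of_real r))"
        using F_eq[OF r1] r by simp
      have "f (of_real r * cis \<theta>) = of_real (1 / \<nu> (of_real r)) * exp (- \<i> * ?a)"
        by (simp add: f_def mult.assoc cis_mult Fr)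
      \<comment> \<open>Here the phases cancel: the exponent has imaginary part
        \<open>Im ?b - Re ?a\<close>, of size at most 1 on \<open>[0,t]\<close>.\<close>
      then have "f (of_real r * cis \<theta>) * deriv g (of_real r * cis \<theta>)
          = of_real (1 / \<nu> (of_real r)) * exp (?b - \<i> * ?a)"
        using exp_h[OF r2] by (simp add: exp_diff exp_minus field_simps)
      then have Re_eq: "Re (f (of_real r * cis \<theta>) * deriv g (of_real r * cis \<theta>))
          = 1 / \<nu> (of_real r) * (exp (Re ?b + Im ?a) * cos (Im ?b - Re ?a))"
        by (simp add: Re_exp)
      have "norm (deriv g (of_real r * cis \<theta>)) = exp (Re ?b)"
        using exp_h[OF r2] by (metis norm_exp_eq_Re)
      then have I_eq: "\<kappa> * ?I r = 1 / \<nu> (of_real r) * (exp (Re ?b - M) * cos 1)"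
        by (simp add: \<kappa>_def exp_diff exp_minus field_simps)
      have "cos 1 \<le> cos \<bar>Im ?b - Re ?a\<bar>"
        using Re_\<phi>[OF r] pi_gt3 by (intro cos_monotone_0_pi_le) auto
      then have "exp (Re ?b - M) * cos 1 \<le> exp (Re ?b + Im ?a) * cos (Im ?b - Re ?a)"
        using Im_\<phi>[OF r1] \<open>0 < cos 1\<close> by (intro mult_mono) auto
      then show "\<kappa> * ?I r \<le> Re (f (of_real r * cis \<theta>) * deriv g (of_real r * cis \<theta>))"
        unfolding Re_eq I_eq using analytic_weight_pos[OF \<nu> r1] by (intro mult_left_mono) auto
    qed
    also have "\<dots> \<le> norm (volterra g f ?z)"
      using complex_Re_le_cmod[of "volterra g f ?z * cis (-\<theta>)"] by (simp add: norm_mult)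
    finally have "\<mu> ?z * (\<kappa> * integral {0..t} ?I) \<le> \<mu> ?z * norm (volterra g f ?z)"
      using weight_nonneg[OF \<mu> z] by (intro mult_left_mono)
    with upper have "\<mu> ?z * (\<kappa> * integral {0..t} ?I) \<le> \<bar>C\<bar> * exp M" by linarith
    moreover have "\<mu> ?z = \<mu> (of_real t)"
      using \<mu> t by (intro weight_rotate) auto
    ultimately show ?thesis
      using \<open>0 < \<kappa>\<close> by (simp add: field_simps)
  qed
  then show ?thesis using that by blast
qed

theorem theorem1:
  fixes g :: "complex \<Rightarrow> complex" and \<nu> \<mu> :: "complex \<Rightarrow> real"
  assumes "g holomorphic_on unit_disc"
    and "log_deriv_in_bloch g"
    and "is_analytic_weight \<nu>"
    and "is_weight \<mu>"
  shows "volterra_bounded g \<nu> \<mu> \<longleftrightarrow>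
    (\<exists>C. \<forall>t\<in>{0..<1}. \<forall>\<theta>\<in>{0..<2*pi}.
       \<mu> (complex_of_real t) *
         integral {0..t} (\<lambda>r. norm (deriv g (complex_of_real r * cis \<theta>)) / \<nu> (complex_of_real r))
       \<le> C)"
proof
  assume "volterra_bounded g \<nu> \<mu>"
  from volterra_bounded_only_if[OF assms this] show "\<exists>C. \<forall>t\<in>{0..<1}. \<forall>\<theta>\<in>{0..<2*pi}.
       \<mu> (complex_of_real t) *
         integral {0..t} (\<lambda>r. norm (deriv g (complex_of_real r * cis \<theta>)) / \<nu> (complex_of_real r))
       \<le> C"
    by metis
next
  assume "\<exists>C. \<forall>t\<in>{0..<1}. \<forall>\<theta>\<in>{0..<2*pi}.
       \<mu> (complex_of_real t) *
         integral {0..t} (\<lambda>r. norm (deriv g (complex_of_real r * cis \<theta>)) / \<nu> (complex_of_real r))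
       \<le> C"
  then obtain C where "\<forall>t\<in>{0..<1}. \<forall>\<theta>\<in>{0..<2*pi}.
       \<mu> (complex_of_real t) *
         integral {0..t} (\<lambda>r. norm (deriv g (complex_of_real r * cis \<theta>)) / \<nu> (complex_of_real r))
       \<le> C" ..
  then show "volterra_bounded g \<nu> \<mu>"
    by (intro volterra_bounded_if[OF assms(1,3,4), of C]) simp
qed

end
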